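(* For every positive integer $k$, the class of graphs with tree-independence number at most $k$ is $(\mathrm{tw},\omega)$-bounded, with a $(\mathrm{tw},\omega)$-binding function $f(p) = R(p+1,k+1)-2$, and this function $f$ is upper-bounded by a polynomial in $p$ of degree $k$.
   Context: All graphs are finite, simple, and undirected. A tree decomposition of a graph $G$ is a pair $\mathcal{T}=(T,\{X_t\}_{t\in V(T)})$ where $T$ is a tree and each node $t$ is assigned a set (bag) $X_t\subseteq V(G)$ such that every vertex of $G$ is in at least one bag, every edge of $G$ has both endpoints in some common bag, and for every $u\in V(G)$ the subgraph of $T$ induced by $\{t: u\in X_t\}$ is connected. Its width is $\max_t |X_t|-1$, and the treewidth $\mathrm{tw}(G)$ is the minimum width of a tree decomposition of $G$. The independence number of $\mathcal{T}$ is $\alpha(\mathcal{T})=\max_{t\in V(T)}\alpha(G[X_t])$, where $\alpha(H)$ is the maximum size of an independent set in $H$. The tree-independence number $\mathsf{tree}\text{-}\alpha(G)$ is the minimum of $\alpha(\mathcal{T})$ over all tree decompositions $\mathcal{T}$ of $G$. The clique number of $G$ is denoted $\omega(G)$. A graph class $\mathcal{G}$ is $(\mathrm{tw},\omega)$-bounded if it admits a $(\mathrm{tw},\omega)$-binding function, that is, a function $f$ such that for every $G\in\mathcal{G}$ and every induced subgraph $G'$ of $G$ we have $\mathrm{tw}(G')\le f(\omega(G'))$. For positive integers $p,q$, the Ramsey number $R(p,q)$ is the least positive integer $N$ such that every graph with at least $N$ vertices contains a clique of size $p$ or an independent set of size $q$. *)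

theory Defs
  imports "Graph_Theory.Graph_Theory" "HOL-Computational_Algebra.Polynomial"
begin

text \<open>
  Finite simple undirected graphs are the symmetric, loop-free digraphs without parallel arcs of the
  locale \<^locale>\<open>graph\<close> (respectively \<^locale>\<open>pair_graph\<close>): an undirected edge is a pair of
  opposite arcs. The null graph is admitted.
\<close>

definition clique_in :: "('a, 'b) pre_digraph \<Rightarrow> 'a set \<Rightarrow> bool" where
  "clique_in G S \<longleftrightarrow> S \<subseteq> verts G \<and> (\<forall>u\<in>S. \<forall>v\<in>S. u \<noteq> v \<longrightarrow> u \<rightarrow>\<^bsub>G\<^esub> v)"

definition independent_in :: "('a, 'b) pre_digraph \<Rightarrow> 'a set \<Rightarrow> bool" where
  "independent_in G S \<longleftrightarrow> S \<subseteq> verts G \<and> (\<forall>u\<in>S. \<forall>v\<in>S. \<not> u \<rightarrow>\<^bsub>G\<^esub> v)"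

definition clique_number :: "('a, 'b) pre_digraph \<Rightarrow> nat" where
  "clique_number G = Max {card S | S. clique_in G S}"

definition independence_number :: "('a, 'b) pre_digraph \<Rightarrow> nat" where
  "independence_number G = Max {card S | S. independent_in G S}"

text \<open>
  The library's \<^const>\<open>tree\<close> cannot be used: in a symmetric digraph every edge gives a directed cycle
  of length 2. The cycles of an undirected simple graph are the directed ones of length at least 3.
  \<^const>\<open>Digraph_Component.connected\<close> includes non-emptiness.
\<close>

definition undirected_tree :: "'a pair_pre_digraph \<Rightarrow> bool" where
  "undirected_tree T \<longleftrightarrow> pair_graph T \<and> Digraph_Component.connected T \<and>
     \<not> (\<exists>c. pre_digraph.cycle T c \<and> 3 \<le> length c)"

text \<open>
  Since trees are finite, it is no restriction to take natural numbers as their nodes.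
\<close>

definition tree_decomposition ::
  "('a, 'b) pre_digraph \<Rightarrow> nat pair_pre_digraph \<Rightarrow> (nat \<Rightarrow> 'a set) \<Rightarrow> bool" where
  "tree_decomposition G T X \<longleftrightarrow>
     undirected_tree T \<and>
     (\<forall>t\<in>pverts T. X t \<subseteq> verts G) \<and>
     (\<forall>u\<in>verts G. \<exists>t\<in>pverts T. u \<in> X t) \<and>
     (\<forall>u v. u \<rightarrow>\<^bsub>G\<^esub> v \<longrightarrow> (\<exists>t\<in>pverts T. u \<in> X t \<and> v \<in> X t)) \<and>
     (\<forall>u\<in>verts G. Digraph_Component.connected (with_proj T \<restriction> {t \<in> pverts T. u \<in> X t}))"

text \<open>
  Widths are integers, so that the null graph has treewidth \<open>-1\<close>.
\<close>

definition td_width :: "nat pair_pre_digraph \<Rightarrow> (nat \<Rightarrow> 'a set) \<Rightarrow> int" where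
  "td_width T X = int (Max ((\<lambda>t. card (X t)) ` pverts T)) - 1"

definition treewidth :: "('a, 'b) pre_digraph \<Rightarrow> int" where
  "treewidth G = Min {td_width T X | T X. tree_decomposition G T X}"

definition td_independence_number ::
  "('a, 'b) pre_digraph \<Rightarrow> nat pair_pre_digraph \<Rightarrow> (nat \<Rightarrow> 'a set) \<Rightarrow> nat" where
  "td_independence_number G T X = Max ((\<lambda>t. independence_number (G \<restriction> X t)) ` pverts T)"

definition tree_independence_number :: "('a, 'b) pre_digraph \<Rightarrow> nat" where
  "tree_independence_number G =
     Min {td_independence_number G T X | T X. tree_decomposition G T X}"

definition tw_omega_binding_function ::
  "('a, 'b) pre_digraph set \<Rightarrow> (nat \<Rightarrow> int) \<Rightarrow> bool" where
  "tw_omega_binding_function \<G> f \<longleftrightarrow>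
     (\<forall>G\<in>\<G>. \<forall>G'. induced_subgraph G' G \<longrightarrow> treewidth G' \<le> f (clique_number G'))"

definition tw_omega_bounded :: "('a, 'b) pre_digraph set \<Rightarrow> bool" where
  "tw_omega_bounded \<G> \<longleftrightarrow> (\<exists>f. tw_omega_binding_function \<G> f)"

text \<open>
  Every finite graph is isomorphic to one whose vertices are natural numbers.
\<close>

definition ramsey_number :: "nat \<Rightarrow> nat \<Rightarrow> nat" where
  "ramsey_number p q = (LEAST N. 0 < N \<and>
     (\<forall>G :: nat pair_pre_digraph. pair_graph G \<and> N \<le> card (pverts G) \<longrightarrow>
        (\<exists>S. clique_in G S \<and> card S = p) \<or> (\<exists>S. independent_in G S \<and> card S = q)))"

end

theory Submission
  imports Defs
begin

text \<open>
  Take a tree decomposition of \<open>G\<close> all of whose bags have independence number at most \<open>k\<close>, and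
  intersect its bags with the vertex set of an induced subgraph \<open>G'\<close>. This is a tree decomposition
  of \<open>G'\<close>, and a bag with at least \<open>R (\<omega> G' + 1) (k + 1)\<close> vertices would contain a clique of \<open>G'\<close>
  that is too large or an independent set of \<open>G\<close> that is too large. The polynomial bound is the
  Erdos--Szekeres estimate \<open>R (p + 1) (k + 1) \<le> (p + k choose k) \<le> (p + k) ^ k\<close>.
\<close>

section \<open>Ramsey numbers\<close>

text \<open>
  The bound of \<open>HOL-Library.Ramsey\<close>, with \<open>a + b + 2 choose a + 1\<close> in place of \<open>a + b choose a\<close>,
  would only give a polynomial of degree \<open>k + 1\<close> in the theorem.
\<close>

lemma erdos_szekeres:
  fixes E :: "'a \<Rightarrow> 'a \<Rightarrow> bool"
  assumes sym: "\<And>u v. E u v \<Longrightarrow> E v u"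
    and "finite V" and "(a + b) choose a \<le> card V"
  shows "(\<exists>S\<subseteq>V. card S = Suc a \<and> (\<forall>u\<in>S. \<forall>v\<in>S. u \<noteq> v \<longrightarrow> E u v)) \<or>
         (\<exists>S\<subseteq>V. card S = Suc b \<and> (\<forall>u\<in>S. \<forall>v\<in>S. u \<noteq> v \<longrightarrow> \<not> E u v))"
  using assms(2,3)
proof (induction "a + b" arbitrary: a b V)
  case 0
  then obtain x where "x \<in> V"
    by fastforce
  with 0 show ?case
    by (intro disjI1 exI[of _ "{x}"]) auto
next
  case (Suc n)
  have "0 < card V"
    using Suc.prems by (metis le_add1 less_le_trans zero_less_binomial)
  then obtain x where x: "x \<in> V"
    by fastforce
  show ?case
  proof (cases "a = 0 \<or> b = 0")
    case True
    \<comment> \<open>A singleton satisfies both conditions vacuously, so it serves whichever of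
      \<open>a\<close> and \<open>b\<close> is zero.\<close>
    have "card {x} = Suc 0" "{x} \<subseteq> V"
      using x by auto
    then have "\<exists>S\<subseteq>V. card S = Suc 0 \<and> (\<forall>u\<in>S. \<forall>v\<in>S. u = v)"
      by blast
    with True show ?thesis
      by blast
  next
    case False
    then obtain a' b' where ab: "a = Suc a'" "b = Suc b'"
      by (metis not0_implies_Suc)
    define N where "N = {v \<in> V - {x}. E x v}"
    define M where "M = {v \<in> V - {x}. \<not> E x v}"
    have NM: "N \<subseteq> V" "M \<subseteq> V" "x \<notin> N" "x \<notin> M"
      by (auto simp: N_def M_def)
    then have fin: "finite N" "finite M"
      using Suc.prems finite_subset by blast+
    have "V = insert x (N \<union> M)" "N \<inter> M = {}"
      using x by (auto simp: N_def M_def)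
    then have "card V = Suc (card N + card M)"
      using fin NM by (simp add: card_Un_disjoint)
    \<comment> \<open>Pascal's rule splits the bound between neighbours \<open>N\<close> and
      non-neighbours \<open>M\<close> of \<open>x\<close>. Were both sets below their shares,
      \<open>N\<close>, \<open>M\<close> and \<open>x\<close> together would fall short of the bound
      by at least one.\<close>
    moreover have "(a + b) choose a = ((a' + b) choose a') + ((a + b') choose a)"
      by (simp add: ab)
    ultimately consider "(a' + b) choose a' \<le> card N" | "(a + b') choose a \<le> card M"
      using Suc.prems by linarith
    then show ?thesis
    proof cases
      case 1
      have "n = a' + b"
        using Suc.hyps ab by simp
      from Suc.hyps(1)[OF this fin(1) 1] show ?thesis
      proof (elim disjE exE conjE)
        fix S assume S: "S \<subseteq> N" "card S = Suc a'" "\<forall>u\<in>S. \<forall>v\<in>S. u \<noteq> v \<longrightarrow> E u v"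
        have "card (insert x S) = Suc a"
          using S NM fin ab by (metis card_insert_disjoint finite_subset subsetD)
        moreover have "\<forall>u\<in>insert x S. \<forall>v\<in>insert x S. u \<noteq> v \<longrightarrow> E u v"
          using S sym by (auto simp: N_def)
        moreover have "insert x S \<subseteq> V"
          using S NM x by auto
        ultimately show ?thesis
          by blast
      next
        fix S assume S: "S \<subseteq> N" "card S = Suc b" "\<forall>u\<in>S. \<forall>v\<in>S. u \<noteq> v \<longrightarrow> \<not> E u v"
        then have "S \<subseteq> V"
          using NM by blast
        with S show ?thesis
          by blast
      qed
    next
      case 2
      have "n = a + b'"
        using Suc.hyps ab by simp
      from Suc.hyps(1)[OF this fin(2) 2] show ?thesis
      proof (elim disjE exE conjE)
        fix S assume S: "S \<subseteq> M" "card S = Suc b'" "\<forall>u\<in>S. \<forall>v\<in>S. u \<noteq> v \<longrightarrow> \<not> E u v"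
        have "card (insert x S) = Suc b"
          using S NM fin ab by (metis card_insert_disjoint finite_subset subsetD)
        moreover have "\<forall>u\<in>insert x S. \<forall>v\<in>insert x S. u \<noteq> v \<longrightarrow> \<not> E u v"
          using S sym by (auto simp: M_def)
        moreover have "insert x S \<subseteq> V"
          using S NM x by auto
        ultimately show ?thesis
          by blast
      next
        fix S assume S: "S \<subseteq> M" "card S = Suc a" "\<forall>u\<in>S. \<forall>v\<in>S. u \<noteq> v \<longrightarrow> E u v"
        then have "S \<subseteq> V"
          using NM by blast
        with S show ?thesis
          by blast
      qed
    qed
  qed
qed

lemma pair_graph_ramsey:
  assumes "pair_graph G" and "(a + b) choose a \<le> card (pverts G)"
  shows "(\<exists>S. clique_in G S \<and> card S = a + 1) \<or> (\<exists>S. independent_in G S \<and> card S = b + 1)"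
proof -
  interpret pair_graph G by fact
  have "(\<exists>S\<subseteq>pverts G. card S = Suc a \<and> (\<forall>u\<in>S. \<forall>v\<in>S. u \<noteq> v \<longrightarrow> u \<rightarrow>\<^bsub>G\<^esub> v)) \<or>
        (\<exists>S\<subseteq>pverts G. card S = Suc b \<and> (\<forall>u\<in>S. \<forall>v\<in>S. u \<noteq> v \<longrightarrow> \<not> u \<rightarrow>\<^bsub>G\<^esub> v))"
    using assms(2) by (intro erdos_szekeres) (auto intro: graph_symmetric arcs_symmetric)
  then show ?thesis
  proof (elim disjE exE conjE)
    fix S assume "S \<subseteq> pverts G" "card S = Suc a" "\<forall>u\<in>S. \<forall>v\<in>S. u \<noteq> v \<longrightarrow> u \<rightarrow>\<^bsub>G\<^esub> v"
    then have "clique_in G S \<and> card S = a + 1"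
      by (simp add: clique_in_def)
    then show ?thesis
      by blast
  next
    fix S assume S: "S \<subseteq> pverts G" "card S = Suc b" "\<forall>u\<in>S. \<forall>v\<in>S. u \<noteq> v \<longrightarrow> \<not> u \<rightarrow>\<^bsub>G\<^esub> v"
    \<comment> \<open>\<open>erdos_szekeres\<close> excludes only arcs between distinct vertices;
      \<open>independent_in\<close> also excludes loops.\<close>
    have "\<not> u \<rightarrow>\<^bsub>G\<^esub> u" for u
      using no_loops by fastforce
    then have "\<forall>u\<in>S. \<forall>v\<in>S. \<not> u \<rightarrow>\<^bsub>G\<^esub> v"
      using S(3) by metis
    then have "independent_in G S \<and> card S = b + 1"
      using S by (simp add: independent_in_def)
    then show ?thesis
      by blast
  qed
qed

text \<open>The binomial coefficient shows that the predicate under \<open>LEAST\<close> can be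
  satisfied. Minimality then gives the bound, and the least value itself has the Ramsey
  property.\<close>

lemma
  shows ramsey_number_le_binomial: "ramsey_number (a + 1) (b + 1) \<le> (a + b) choose a"
    and ramsey_number_spec: "\<And>G :: nat pair_pre_digraph. pair_graph G \<Longrightarrow>
      ramsey_number (a + 1) (b + 1) \<le> card (pverts G) \<Longrightarrow>
      (\<exists>S. clique_in G S \<and> card S = a + 1) \<or> (\<exists>S. independent_in G S \<and> card S = b + 1)"
proof -
  let ?P = "\<lambda>N. 0 < N \<and>
     (\<forall>G :: nat pair_pre_digraph. pair_graph G \<and> N \<le> card (pverts G) \<longrightarrow>
        (\<exists>S. clique_in G S \<and> card S = a + 1) \<or> (\<exists>S. independent_in G S \<and> card S = b + 1))"
  have P: "?P ((a + b) choose a)"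
    using pair_graph_ramsey by (auto simp del: Suc_eq_plus1)
  show "ramsey_number (a + 1) (b + 1) \<le> (a + b) choose a"
    unfolding ramsey_number_def by (rule Least_le) (rule P)
  have "?P (ramsey_number (a + 1) (b + 1))"
    unfolding ramsey_number_def by (rule LeastI) (rule P)
  then show "\<And>G :: nat pair_pre_digraph. pair_graph G \<Longrightarrow>
      ramsey_number (a + 1) (b + 1) \<le> card (pverts G) \<Longrightarrow>
      (\<exists>S. clique_in G S \<and> card S = a + 1) \<or> (\<exists>S. independent_in G S \<and> card S = b + 1)"
    by blast
qed

text \<open>\<open>ramsey_number\<close> quantifies only over graphs on natural numbers. The
  subgraph induced by \<open>V\<close> is therefore copied along an injection into the naturals, and
  the set found there is pulled back.\<close>

lemma (in graph) ramsey_number_subset: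
  assumes "V \<subseteq> verts G" and card: "ramsey_number (a + 1) (b + 1) \<le> card V"
  obtains S where "S \<subseteq> V" "clique_in G S" "card S = a + 1"
  | S where "S \<subseteq> V" "independent_in G S" "card S = b + 1"
proof -
  have fin: "finite V"
    using assms(1) finite_verts finite_subset by blast
  then obtain g :: "'a \<Rightarrow> nat" where g: "inj_on g V"
    using finite_imp_inj_to_nat_seg by blast
  define H where "H = \<lparr>pverts = g ` V, parcs = {(g u, g v) | u v. u \<in> V \<and> v \<in> V \<and> u \<rightarrow>\<^bsub>G\<^esub> v}\<rparr>"
  have arc: "g u \<rightarrow>\<^bsub>H\<^esub> g v \<longleftrightarrow> u \<rightarrow>\<^bsub>G\<^esub> v" if "u \<in> V" "v \<in> V" for u v
    using that g by (auto simp: H_def dest: inj_onD)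
  have "pair_graph H"
  proof
    show "finite (parcs H)"
      by (rule finite_subset[of _ "g ` V \<times> g ` V"]) (auto simp: H_def fin)
    show "symmetric H"
      by (auto simp: symmetric_def sym_def H_def dest: graph_symmetric)
    show "fst e \<noteq> snd e" if "e \<in> parcs H" for e
      using that inj_onD[OF g] no_loops by (fastforce simp: H_def arcs_ends_conv)
  qed (auto simp: H_def fin)
  moreover have "card (pverts H) = card V"
    by (simp add: H_def card_image g)
  ultimately consider S where "clique_in H S" "card S = a + 1"
    | S where "independent_in H S" "card S = b + 1"
    using ramsey_number_spec[of H a b] card by auto
  then show thesis
  proof cases
    case 1
    then have "S \<subseteq> g ` V"
      by (simp add: clique_in_def H_def)
    then obtain S' where S': "S' \<subseteq> V" "S = g ` S'"
      by (meson subset_image_iff)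
    then have "inj_on g S'"
      using g inj_on_subset by blast
    \<comment> \<open>Adjacency in a clique is required only of distinct vertices, so injectivity is
      needed to keep their images distinct.\<close>
    then have "clique_in G S'"
      using 1 S' assms(1) arc unfolding clique_in_def
      by (metis (no_types, lifting) imageI inj_onD order_trans subsetD)
    moreover have "card S' = a + 1"
      using \<open>inj_on g S'\<close> 1 S' card_image by metis
    ultimately show thesis
      using that(1) S' by blast
  next
    case 2
    then have "S \<subseteq> g ` V"
      by (simp add: independent_in_def H_def)
    then obtain S' where S': "S' \<subseteq> V" "S = g ` S'"
      by (meson subset_image_iff)
    then have "inj_on g S'"
      using g inj_on_subset by blast
    have "independent_in G S'"
      using 2 S' assms(1) arc unfolding independent_in_def
      by (metis (no_types, lifting) imageI order_trans subsetD)
    moreover have "card S' = b + 1"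
      using \<open>inj_on g S'\<close> 2 S' card_image by metis
    ultimately show thesis
      using that(2) S' by blast
  qed
qed

section \<open>Graph parameters as attained extrema\<close>

lemma card_le_clique_number:
  assumes "finite (verts G)" and "clique_in G S"
  shows "card S \<le> clique_number G"
proof -
  have "{card S | S. clique_in G S} \<subseteq> {..card (verts G)}"
    using assms(1) by (auto simp: clique_in_def card_mono)
  then have "finite {card S | S. clique_in G S}"
    by (rule finite_subset) simp
  then show ?thesis
    unfolding clique_number_def using assms(2) by (intro Max_ge) auto
qed

lemma finite_independent_cards:
  assumes "finite (verts G)"
  shows "finite {card S | S. independent_in G S}"
proof -
  have "{card S | S. independent_in G S} \<subseteq> {..card (verts G)}"
    using assms by (auto simp: independent_in_def card_mono)
  then show ?thesis
    by (rule finite_subset) simp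
qed

lemma card_le_independence_number:
  assumes "finite (verts G)" and "independent_in G S"
  shows "card S \<le> independence_number G"
  unfolding independence_number_def using assms
  by (intro Max_ge finite_independent_cards) auto

lemma independence_number_le_card:
  assumes "finite (verts G)"
  shows "independence_number G \<le> card (verts G)"
proof -
  \<comment> \<open>This keeps the set under \<open>Max\<close> nonempty, even for the null
    graph.\<close>
  have "independent_in G {}"
    by (simp add: independent_in_def)
  then show ?thesis
    unfolding independence_number_def using assms
    by (subst Max_le_iff) (auto simp: finite_independent_cards independent_in_def card_mono)
qed

lemma tree_decomposition_nodes:
  assumes "tree_decomposition G T X"
  shows "finite (pverts T)" "pverts T \<noteq> {}"
proof -
  have "pair_graph T" "Digraph_Component.connected T"
    using assms by (auto simp: tree_decomposition_def undirected_tree_def)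
  then show "finite (pverts T)" "pverts T \<noteq> {}"
    by (auto simp: pair_graph_def pair_digraph_def pair_fin_digraph_def pair_fin_digraph_axioms_def
        Digraph_Component.connected_def strongly_connected_def mk_symmetric_def)
qed

text \<open>A graph has infinitely many tree decompositions, but their widths lie in a finite
  interval, so the \<open>Min\<close> in \<open>treewidth\<close> is a genuine minimum.\<close>

lemma treewidth_le:
  assumes "finite (verts G)" and "tree_decomposition G T X"
  shows "treewidth G \<le> td_width T X"
proof -
  have "td_width T' X' \<in> {-1..int (card (verts G)) - 1}" if td: "tree_decomposition G T' X'" for T' X'
  proof -
    have "Max ((\<lambda>t. card (X' t)) ` pverts T') \<le> card (verts G)"
      using tree_decomposition_nodes[OF td] td assms(1)
      by (subst Max_le_iff) (auto simp: tree_decomposition_def intro!: card_mono)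
    then show ?thesis
      by (simp add: td_width_def)
  qed
  then have "{td_width T X | T X. tree_decomposition G T X} \<subseteq> {-1..int (card (verts G)) - 1}"
    by blast
  then have "finite {td_width T X | T X. tree_decomposition G T X}"
    by (rule finite_subset) simp
  then show ?thesis
    unfolding treewidth_def using assms(2) by (intro Min_le) auto
qed

lemma trivial_tree_decomposition:
  assumes "wf_digraph G"
  shows "tree_decomposition G \<lparr>pverts = {0}, parcs = {}\<rparr> (\<lambda>_. verts G)"
proof -
  let ?T = "\<lparr>pverts = {0::nat}, parcs = {}\<rparr>"
  interpret wf_digraph G by fact
  have "pair_graph ?T"
    by unfold_locales (auto simp: symmetric_def)
  \<comment> \<open>A general \<open>H\<close> covers both the tree itself and its restriction to
    the nodes whose bags contain a given vertex.\<close>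
  moreover have conn: "Digraph_Component.connected H" if "verts H = {0::nat}" for H :: "(nat, nat \<times> nat) pre_digraph"
    using that unfolding Digraph_Component.connected_def strongly_connected_def mk_symmetric_def reachable_def
    by (auto intro: rtrancl_on_refl)
  moreover have "\<not> (\<exists>c. pre_digraph.cycle ?T c \<and> 3 \<le> length c)"
    by (auto simp: pre_digraph.cycle_def pre_digraph.awalk_def)
  ultimately have "undirected_tree ?T"
    by (simp add: undirected_tree_def)
  moreover have "u \<in> verts G \<and> v \<in> verts G" if "u \<rightarrow>\<^bsub>G\<^esub> v" for u v
    using that by (auto simp: arcs_ends_conv)
  ultimately show ?thesis
    unfolding tree_decomposition_def by (auto intro!: conn)
qed

text \<open>The values are bounded by the number of vertices, and the one-bag decomposition provides
  one, so the minimum belongs to an actual decomposition.\<close>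

lemma tree_independence_number_attained:
  assumes "wf_digraph G" and fin: "finite (verts G)"
  obtains T X where "tree_decomposition G T X"
    "td_independence_number G T X = tree_independence_number G"
proof -
  have "td_independence_number G T X \<le> card (verts G)" if td: "tree_decomposition G T X" for T X
  proof -
    have sub: "X t \<subseteq> verts G" if "t \<in> pverts T" for t
      using td that by (auto simp: tree_decomposition_def)
    have "independence_number (G \<restriction> X t) \<le> card (verts G)" if "t \<in> pverts T" for t
      using independence_number_le_card[of "G \<restriction> X t"] sub[OF that] fin
      by (metis card_mono finite_subset induce_subgraph_verts order_trans)
    then show ?thesis
      unfolding td_independence_number_def using tree_decomposition_nodes[OF td]
      by (subst Max_le_iff) auto
  qed
  then have "{td_independence_number G T X | T X. tree_decomposition G T X} \<subseteq> {..card (verts G)}"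
    by blast
  then have "finite {td_independence_number G T X | T X. tree_decomposition G T X}"
    by (rule finite_subset) simp
  moreover have "{td_independence_number G T X | T X. tree_decomposition G T X} \<noteq> {}"
    using trivial_tree_decomposition[OF assms(1)] by blast
  ultimately have "tree_independence_number G \<in>
      {td_independence_number G T X | T X. tree_decomposition G T X}"
    unfolding tree_independence_number_def by (rule Min_in)
  then show thesis
    using that by fastforce
qed

section \<open>Induced subgraphs\<close>

lemma induced_subgraph_dominates_iff:
  assumes "induced_subgraph H G"
  shows "u \<rightarrow>\<^bsub>H\<^esub> v \<longleftrightarrow> u \<rightarrow>\<^bsub>G\<^esub> v \<and> u \<in> verts H \<and> v \<in> verts H"
  using assms by (auto simp: induced_subgraph_def subgraph_def compatible_def arcs_ends_conv)

lemma tree_decomposition_induced_subgraph: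
  assumes td: "tree_decomposition G T X" and ind: "induced_subgraph H G"
  shows "tree_decomposition H T (\<lambda>t. X t \<inter> verts H)"
proof -
  have sub: "verts H \<subseteq> verts G"
    using ind by (simp add: induced_subgraph_def subgraph_def)
  \<comment> \<open>For a vertex of \<open>H\<close> the subgraph of \<open>T\<close> to be
    connected is unchanged.\<close>
  have "{t \<in> pverts T. u \<in> X t \<inter> verts H} = {t \<in> pverts T. u \<in> X t}" if "u \<in> verts H" for u
    using that by auto
  then show ?thesis
    using td sub unfolding tree_decomposition_def induced_subgraph_dominates_iff[OF ind]
    by (simp add: subset_iff)
qed

lemma treewidth_induced_subgraph_le_ramsey:
  assumes "graph G" and "tree_independence_number G \<le> k" and ind: "induced_subgraph H G"
  shows "treewidth H \<le> int (ramsey_number (clique_number H + 1) (k + 1)) - 2"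
proof -
  interpret graph G by fact
  have sub: "verts H \<subseteq> verts G"
    using ind by (simp add: induced_subgraph_def subgraph_def)
  then have finH: "finite (verts H)"
    using finite_subset[OF _ finite_verts] by blast
  obtain T X where td: "tree_decomposition G T X"
    and "td_independence_number G T X = tree_independence_number G"
    using tree_independence_number_attained[OF wf_digraph finite_verts] .
  then have "td_independence_number G T X \<le> k"
    using assms(2) by simp
  note nodes = tree_decomposition_nodes[OF td]
  have indep: "independence_number (G \<restriction> X t) \<le> k" if "t \<in> pverts T" for t
    using \<open>td_independence_number G T X \<le> k\<close> nodes that
    by (simp add: td_independence_number_def)
  let ?R = "ramsey_number (clique_number H + 1) (k + 1)"
  have "card (X t \<inter> verts H) < ?R" if t: "t \<in> pverts T" for t
  proof (rule ccontr)
    assume "\<not> card (X t \<inter> verts H) < ?R"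
    then have "?R \<le> card (X t \<inter> verts H)"
      by simp
    moreover have "X t \<inter> verts H \<subseteq> verts G"
      using sub by auto
    ultimately consider
        S where "S \<subseteq> X t \<inter> verts H" "clique_in G S" "card S = clique_number H + 1"
      | S where "S \<subseteq> X t \<inter> verts H" "independent_in G S" "card S = k + 1"
      using ramsey_number_subset by metis
    then show False
    proof cases
      case 1
      then have "clique_in H S"
        by (auto simp: clique_in_def induced_subgraph_dominates_iff[OF ind])
      then show False
        using card_le_clique_number[OF finH] 1 by fastforce
    next
      case 2
      have "finite (X t)"
        using td t finite_subset[OF _ finite_verts] by (auto simp: tree_decomposition_def)
      \<comment> \<open>The bound \<open>k\<close> concerns the full bag in \<open>G\<close>, so
        \<open>S\<close> is viewed there and not in \<open>H\<close>.\<close>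
      moreover have "independent_in (G \<restriction> X t) S"
        using 2 by (auto simp: independent_in_def dest: dominates_induce_subgraphD)
      ultimately have "card S \<le> k"
        using card_le_independence_number[of "G \<restriction> X t" S] indep[OF t] by simp
      then show False
        using 2 by simp
    qed
  qed
  then have "Max ((\<lambda>t. card (X t \<inter> verts H)) ` pverts T) < ?R"
    using nodes by (subst Max_less_iff) auto
  \<comment> \<open>One unit comes from the strict inequality, the other from the definition of
    width.\<close>
  then have "td_width T (\<lambda>t. X t \<inter> verts H) \<le> int ?R - 2"
    by (simp add: td_width_def)
  then show ?thesis
    using treewidth_le[OF finH tree_decomposition_induced_subgraph[OF td ind]] by simp
qed

theorem lemma3p2:
  fixes k :: nat and f :: "nat \<Rightarrow> int" and \<G> :: "('a, 'b) pre_digraph set"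
  assumes "0 < k"
    and "\<G> = {G. graph G \<and> tree_independence_number G \<le> k}"
    and "\<And>p. f p = int (ramsey_number (p + 1) (k + 1)) - 2"
  shows "tw_omega_bounded \<G> \<and>
         tw_omega_binding_function \<G> f \<and>
         (\<exists>P :: real poly. degree P = k \<and> (\<forall>p. real_of_int (f p) \<le> poly P (real p)))"
proof -
  have binding: "tw_omega_binding_function \<G> f"
    using treewidth_induced_subgraph_le_ramsey
    by (auto simp: tw_omega_binding_function_def assms(2,3) simp del: Suc_eq_plus1)
  \<comment> \<open>The witness is the polynomial (x + k)^k.\<close>
  have "real_of_int (f p) \<le> poly ([:real k, 1:] ^ k) (real p)" for p
  proof -
    have "ramsey_number (p + 1) (k + 1) \<le> (p + k) choose p"
      by (rule ramsey_number_le_binomial)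
    \<comment> \<open>With lower index \<open>k\<close>, the power bound has an exponent independent
      of \<open>p\<close>.\<close>
    also have "\<dots> = (p + k) choose k"
      using binomial_symmetric[of p "p + k"] by simp
    also have "\<dots> \<le> (p + k) ^ k"
      by (rule binomial_le_pow) simp
    finally have "f p \<le> int ((p + k) ^ k)"
      unfolding assms(3) by linarith
    then have "real_of_int (f p) \<le> real ((p + k) ^ k)"
      by linarith
    then show ?thesis
      by (simp add: poly_power add.commute)
  qed
  moreover have "degree ([:real k, 1:] ^ k) = k"
    by (rule degree_linear_power)
  ultimately show ?thesis
    using binding unfolding tw_omega_bounded_def by blast
qed

end
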